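(* Let $x_0=0$ and let $\{x_n\}_{n\in\mathbb{N}}$ be a strictly increasing sequence of positive numbers with $\lim_{n\to+\infty}x_n=+\infty$ and $\inf_{n\in\mathbb{N}}(x_n-x_{n-1})>1$. Let $C$ be the comb domain \[C=\{z\in\mathbb{C}:\mathrm{Re}\, z>-x_1\}\setminus\bigcup_{n\in\mathbb{N}\cup\{0\}}\{x_n+iy: y\in\mathbb{R},\ |y|\ge 1\},\] and set $\alpha_n=x_n-x_{n-1}$ for $n\in\mathbb{N}$. If \[\lim_{n\to+\infty}\frac{\log\alpha_n}{n}=0,\] then ${\rm h}(C)=+\infty$.
   Context: $\mathbb{N}=\{1,2,3,\dots\}$ and $\mathbb{D}$ is the open unit disk in $\mathbb{C}$. For $p>0$, the Hardy space $H^p(\mathbb{D})$ is the set of all holomorphic functions $f$ on $\mathbb{D}$ with $\sup_{0<r<1}\int_0^{2\pi}|f(re^{i\theta})|^p\,d\theta<+\infty$. If $D\ne\mathbb{C}$ is a simply connected domain and $f$ is a Riemann mapping (conformal bijection) from $\mathbb{D}$ onto $D$, the Hardy number of $D$ is ${\rm h}(D)=\sup\{p>0: f\in H^p(\mathbb{D})\}\in[1/2,+\infty]$; it does not depend on the choice of $f$. *)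

theory Defs
  imports "HOL-Complex_Analysis.Complex_Analysis" "HOL-Library.Extended_Real"
begin

text \<open>For holomorphic \<open>f\<close> and \<open>p > 0\<close> the integrand is continuous, so boundedness of the set of real
  integrals is exactly finiteness of the supremum.\<close>

definition hardy_space :: "real \<Rightarrow> (complex \<Rightarrow> complex) set" where
  "hardy_space p = {f. f holomorphic_on ball 0 1 \<and>
     bdd_above ((\<lambda>r. integral {0..2*pi}
        (\<lambda>\<theta>. norm (f (complex_of_real r * exp (\<i> * complex_of_real \<theta>))) powr p)) ` {0<..<1})}"

definition riemann_mapping :: "(complex \<Rightarrow> complex) \<Rightarrow> complex set \<Rightarrow> bool" where
  "riemann_mapping f D \<longleftrightarrow> f holomorphic_on ball 0 1 \<and> bij_betw f (ball 0 1) D"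

text \<open>Only meaningful for simply connected domains \<open>D \<noteq> UNIV\<close>: these have a Riemann mapping, and the
  supremum does not depend on which one is chosen.\<close>

definition hardy_number :: "complex set \<Rightarrow> ereal" where
  "hardy_number D =
     Sup (ereal ` {p. p > 0 \<and> (SOME f. riemann_mapping f D) \<in> hardy_space p})"

definition comb_domain :: "(nat \<Rightarrow> real) \<Rightarrow> complex set" where
  "comb_domain x = {z. Re z > - x 1} - (\<Union>n. {Complex (x n) y | y. \<bar>y\<bar> \<ge> 1})"

end

theory Submission
  imports Defs
begin

text \<open>
  It suffices to find, for every even \<open>k\<close>, a superharmonic majorant of \<open>|z|^k\<close> on the comb domain:
  composed with a Riemann mapping, it bounds the circle means by its value at the image of \<open>0\<close>.
  Since \<open>|z|^k \<le> A |Re z|^k + 2 Re ((i z)^k)\<close> and the last term is harmonic, a majorant of \<open>|Re z|^k\<close>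
  is enough, so the vertical extent of the comb plays no role.

  The function \<open>Re (csqrt (1 + (z - x n)^2))\<close> is harmonic off the two slits over \<open>x n\<close>, is at most \<open>1\<close> on
  the gate between them, and is at least \<open>|Re z - x n|\<close> everywhere. Let \<open>W n\<close> be \<open>c^n\<close> times one plus this
  function. As all gaps are at least \<open>\<delta> > 1\<close>, one can fix \<open>c > 1\<close> with \<open>2 c < 1 + \<delta>\<close>, and then
  on the \<open>n\<close>-th gate \<open>W n\<close> is smaller than both \<open>W (n - 1)\<close> and \<open>W (n + 1)\<close>. Hence taking
  \<open>min (W n) (W (n + 1))\<close> over \<open>x n \<le> Re z < x (n + 1)\<close> glues to a superharmonic function which is at
  least \<open>c^n\<close> there, whereas \<open>x n\<close> grows more slowly than every exponential.
\<close>

section \<open>Superharmonic functions\<close>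

text \<open>Being touched from above at each point by a harmonic function implies superharmonicity,
  and is all that the minimum principle needs.\<close>

definition harmonic_supports_on :: "complex set \<Rightarrow> (complex \<Rightarrow> real) \<Rightarrow> bool" where
  "harmonic_supports_on S v \<longleftrightarrow> continuous_on S v \<and>
     (\<forall>z\<in>S. \<exists>N G. open N \<and> z \<in> N \<and> N \<subseteq> S \<and> G holomorphic_on N \<and>
        v z = Re (G z) \<and> (\<forall>y\<in>N. v y \<le> Re (G y)))"

section \<open>Closure properties of functions with harmonic supports\<close>

lemma harmonic_supports_on_Re:
  assumes "open S" "G holomorphic_on S"
  shows "harmonic_supports_on S (\<lambda>z. Re (G z))"
  unfolding harmonic_supports_on_def
  using assms by (blast intro: continuous_on_Re holomorphic_on_imp_continuous_on)

text \<open>At each point, whichever of \<open>G\<close>, \<open>H\<close> has the smaller real part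
  there touches the minimum and lies above it nearby. A single function is covered by
  \<open>G = H\<close>.\<close>

lemma harmonic_supports_on_local_min:
  assumes "\<And>z. z \<in> S \<Longrightarrow> \<exists>N G H. open N \<and> z \<in> N \<and> N \<subseteq> S \<and> G holomorphic_on N \<and> H holomorphic_on N
     \<and> (\<forall>y\<in>N. v y = min (Re (G y)) (Re (H y)))"
  shows "harmonic_supports_on S v"
  unfolding harmonic_supports_on_def
proof (intro conjI ballI)
  show "continuous_on S v"
  proof (rule continuous_at_imp_continuous_on, rule ballI)
    fix z assume "z \<in> S"
    then obtain N G H where N: "open N" "z \<in> N" "N \<subseteq> S" "G holomorphic_on N" "H holomorphic_on N"
      "\<forall>y\<in>N. v y = min (Re (G y)) (Re (H y))"
      using assms by meson
    have "continuous_on N (\<lambda>y. min (Re (G y)) (Re (H y)))"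
      using N(4,5) by (intro continuous_on_min continuous_on_Re holomorphic_on_imp_continuous_on)
    then have "continuous_on N v" using N(6) by (simp cong: continuous_on_cong)
    then show "isCont v z" using N(1,2) by (simp add: continuous_on_eq_continuous_at)
  qed
next
  fix z assume "z \<in> S"
  then obtain N G H where N: "open N" "z \<in> N" "N \<subseteq> S" "G holomorphic_on N" "H holomorphic_on N"
    "\<forall>y\<in>N. v y = min (Re (G y)) (Re (H y))"
    using assms by meson
  show "\<exists>N G. open N \<and> z \<in> N \<and> N \<subseteq> S \<and> G holomorphic_on N \<and>
        v z = Re (G z) \<and> (\<forall>y\<in>N. v y \<le> Re (G y))"
  proof (cases "Re (G z) \<le> Re (H z)")
    case True
    then show ?thesis using N by (intro exI[of _ N] exI[of _ G]) auto
  next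
    case False
    then show ?thesis using N by (intro exI[of _ N] exI[of _ H]) auto
  qed
qed

lemma harmonic_supports_on_add:
  assumes "harmonic_supports_on S u" "harmonic_supports_on S v"
  shows "harmonic_supports_on S (\<lambda>z. u z + v z)"
  unfolding harmonic_supports_on_def
proof (intro conjI ballI)
  show "continuous_on S (\<lambda>z. u z + v z)"
    using assms by (simp add: harmonic_supports_on_def continuous_on_add)
next
  fix z assume z: "z \<in> S"
  obtain N G where NG: "open N" "z \<in> N" "N \<subseteq> S" "G holomorphic_on N" "u z = Re (G z)" "\<forall>y\<in>N. u y \<le> Re (G y)"
    using assms(1) z unfolding harmonic_supports_on_def by blast
  obtain M H where MH: "open M" "z \<in> M" "M \<subseteq> S" "H holomorphic_on M" "v z = Re (H z)" "\<forall>y\<in>M. v y \<le> Re (H y)"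
    using assms(2) z unfolding harmonic_supports_on_def by blast
  show "\<exists>N G. open N \<and> z \<in> N \<and> N \<subseteq> S \<and> G holomorphic_on N \<and>
        u z + v z = Re (G z) \<and> (\<forall>y\<in>N. u y + v y \<le> Re (G y))"
  proof (intro exI conjI)
    show "(\<lambda>z. G z + H z) holomorphic_on N \<inter> M"
      using NG(4) MH(4) by (auto intro!: holomorphic_intros intro: holomorphic_on_subset)
  qed (use NG MH in \<open>auto intro: add_mono\<close>)
qed

lemma harmonic_supports_on_sum:
  assumes "open S" "\<And>i. i \<in> I \<Longrightarrow> harmonic_supports_on S (v i)"
  shows "harmonic_supports_on S (\<lambda>z. \<Sum>i\<in>I. v i z)"
  using assms(2)
proof (induction I rule: infinite_finite_induct)
  case (insert i I)
  then show ?case by (simp add: harmonic_supports_on_add)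
qed (use harmonic_supports_on_Re[OF assms(1), of "\<lambda>_. 0"] in simp_all)

lemma harmonic_supports_on_cmult:
  assumes "harmonic_supports_on S v" "c \<ge> 0"
  shows "harmonic_supports_on S (\<lambda>z. c * v z)"
  unfolding harmonic_supports_on_def
proof (intro conjI ballI)
  show "continuous_on S (\<lambda>z. c * v z)"
    using assms by (simp add: harmonic_supports_on_def continuous_on_mult_left)
next
  fix z assume z: "z \<in> S"
  obtain N G where NG: "open N" "z \<in> N" "N \<subseteq> S" "G holomorphic_on N" "v z = Re (G z)" "\<forall>y\<in>N. v y \<le> Re (G y)"
    using assms(1) z unfolding harmonic_supports_on_def by blast
  show "\<exists>N G. open N \<and> z \<in> N \<and> N \<subseteq> S \<and> G holomorphic_on N \<and>
        c * v z = Re (G z) \<and> (\<forall>y\<in>N. c * v y \<le> Re (G y))"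
    by (rule exI[of _ N], rule exI[of _ "\<lambda>z. of_real c * G z"])
       (use NG assms(2) in \<open>auto intro!: holomorphic_intros mult_left_mono\<close>)
qed

text \<open>Used with rotations of the disk for the circle means, and with a Riemann mapping to
  carry the potential from the comb to the disk.\<close>

lemma harmonic_supports_on_compose:
  assumes v: "harmonic_supports_on S v" and f: "f holomorphic_on T" "f ` T \<subseteq> S" and "open T"
  shows "harmonic_supports_on T (\<lambda>z. v (f z))"
  unfolding harmonic_supports_on_def
proof (intro conjI ballI)
  have cf: "continuous_on T f" using f holomorphic_on_imp_continuous_on by blast
  show "continuous_on T (\<lambda>z. v (f z))"
    using v f(2) cf by (auto simp: harmonic_supports_on_def intro: continuous_on_compose2)
  fix z assume z: "z \<in> T"
  then obtain N G where NG: "open N" "f z \<in> N" "N \<subseteq> S" "G holomorphic_on N" "v (f z) = Re (G (f z))"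
    "\<forall>y\<in>N. v y \<le> Re (G y)"
    using v z f(2) unfolding harmonic_supports_on_def by blast
  have "open (T \<inter> f -` N)"
    using continuous_open_preimage[OF cf \<open>open T\<close> \<open>open N\<close>] by simp
  moreover have "(G \<circ> f) holomorphic_on T \<inter> f -` N"
    by (rule holomorphic_on_compose_gen[OF holomorphic_on_subset[OF f(1)] NG(4)]) auto
  ultimately show "\<exists>N G. open N \<and> z \<in> N \<and> N \<subseteq> T \<and> G holomorphic_on N \<and>
        v (f z) = Re (G z) \<and> (\<forall>y\<in>N. v (f y) \<le> Re (G y))"
    using NG z by (intro exI[of _ "T \<inter> f -` N"] exI[of _ "G \<circ> f"]) auto
qed

section \<open>The minimum principle\<close>

text \<open>Take an interior minimiser of largest modulus. A support \<open>G\<close> there also has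
  minimal real part, so \<open>exp (- G)\<close> has maximal modulus and is constant. As
  \<open>v\<close> lies below \<open>Re G\<close>, a whole ball consists of minimisers, against the
  choice of the point.\<close>

lemma harmonic_supports_on_minimum:
  assumes v: "harmonic_supports_on S v" and sub: "cball 0 r \<subseteq> S" and "0 < r"
    and m: "\<And>z. norm z = r \<Longrightarrow> m \<le> v z"
  shows "m \<le> v 0"
proof (rule ccontr)
  assume "\<not> m \<le> v 0"
  have cont: "continuous_on (cball 0 r) v"
    using v sub by (auto simp: harmonic_supports_on_def intro: continuous_on_subset)
  then obtain z0 where z0: "z0 \<in> cball 0 r" "\<And>z. z \<in> cball 0 r \<Longrightarrow> v z0 \<le> v z"
    using continuous_attains_inf[of "cball 0 r" v] \<open>0 < r\<close> by force
  have less: "v z0 < m"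
    using z0(2)[of 0] \<open>0 < r\<close> \<open>\<not> m \<le> v 0\<close> by simp
  define E where "E = {z \<in> cball 0 r. v z = v z0}"
  have "closed E"
    unfolding E_def using continuous_closed_preimage_constant[OF cont] by simp
  moreover have "E = cball 0 r \<inter> E" by (auto simp: E_def)
  ultimately have "compact E" by (metis compact_Int_closed compact_cball)
  then obtain z1 where z1: "z1 \<in> E" "\<And>z. z \<in> E \<Longrightarrow> norm z \<le> norm z1"
    using continuous_attains_sup[of E norm] z0(1) by (auto simp: E_def intro: continuous_on_norm_id)
  have "norm z1 \<noteq> r" using m[of z1] z1(1) less by (auto simp: E_def)
  then have n1: "norm z1 < r" using z1(1) by (auto simp: E_def)
  then have "z1 \<in> S" using sub by auto
  then obtain N G where NG: "open N" "z1 \<in> N" "N \<subseteq> S" "G holomorphic_on N" "v z1 = Re (G z1)"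
    "\<forall>y\<in>N. v y \<le> Re (G y)"
    using v unfolding harmonic_supports_on_def by blast
  have "open (N \<inter> ball 0 r)" "z1 \<in> N \<inter> ball 0 r" using NG n1 by auto
  then obtain e where e: "e > 0" "ball z1 e \<subseteq> N \<inter> ball 0 r"
    by (meson open_contains_ball)
  have min: "Re (G z1) \<le> Re (G y)" if "y \<in> ball z1 e" for y
  proof -
    have "y \<in> N" "y \<in> cball 0 r" using that e by auto
    then show ?thesis using z0(2)[of y] NG(5,6) z1(1) by (force simp: E_def)
  qed
  have "(\<lambda>y. exp (- G y)) constant_on ball z1 e"
  proof (rule maximum_modulus_principle[where U = "ball z1 e" and \<xi> = z1])
    show "(\<lambda>y. exp (- G y)) holomorphic_on ball z1 e"
      using NG(4) e by (auto intro!: holomorphic_intros intro: holomorphic_on_subset)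
  qed (use e min in auto)
  then obtain c where c: "\<And>y. y \<in> ball z1 e \<Longrightarrow> exp (- G y) = c"
    by (auto simp: constant_on_def)
  have E: "y \<in> E" if y: "y \<in> ball z1 e" for y
  proof -
    have "norm (exp (- G y)) = norm (exp (- G z1))"
      using c[OF y] c[of z1] e by simp
    then have "Re (G y) = Re (G z1)" by simp
    moreover have "y \<in> N" "y \<in> cball 0 r" using y e by auto
    ultimately show ?thesis
      using z0(2)[of y] NG(5,6) z1(1) by (force simp: E_def)
  qed
  \<comment> \<open>Moving radially outward from \<open>z1\<close> inside the ball gives a minimiser
    of larger modulus; at \<open>z1 = 0\<close>, where \<open>sgn\<close> gives no direction, any
    direction serves.\<close>
  show False
  proof (cases "z1 = 0")
    case True
    then have "of_real (e/2) \<in> E" using e by (intro E) (auto simp: dist_norm)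
    then show False using z1(2)[of "of_real (e/2)"] True e by simp
  next
    case False
    define y where "y = z1 + of_real (e / 2) * sgn z1"
    have "y \<in> E" using e False by (intro E) (auto simp: y_def dist_norm norm_mult norm_sgn)
    moreover have "y = of_real (1 + e / (2 * norm z1)) * z1"
      using False by (simp add: y_def sgn_div_norm scaleR_conv_of_real field_simps)
    then have "norm y = \<bar>1 + e / (2 * norm z1)\<bar> * norm z1"
      by (simp only: norm_mult norm_of_real)
    moreover have "1 + e / (2 * norm z1) > 1" using e False by simp
    ultimately show False
      using z1(2)[of y] False by simp
  qed
qed

section \<open>Means over circles\<close>

lemma integral_sum_adjacent:
  fixes g :: "real \<Rightarrow> real"
  assumes "continuous_on UNIV g" "h \<ge> 0"
  shows "integral {a..a + real n * h} g = (\<Sum>k<n. integral {a + real k * h..a + real (Suc k) * h} g)"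
proof (induction n)
  case (Suc n)
  have "integral {a..a + real n * h} g + integral {a + real n * h..a + real (Suc n) * h} g
      = integral {a..a + real (Suc n) * h} g"
    using assms by (intro Henstock_Kurzweil_Integration.integral_combine integrable_continuous_real)
      (auto simp: algebra_simps intro: continuous_on_subset)
  then show ?case using Suc by simp
qed simp

lemma integral_periodic:
  fixes g :: "real \<Rightarrow> real"
  assumes "continuous_on UNIV g" "\<And>t. g (t + T) = g t" "a \<ge> 0" "T \<ge> 0"
  shows "integral {a..a + T} g = integral {0..T} g"
proof -
  have int: "g integrable_on {c..d}" for c d
    using assms(1) by (intro integrable_continuous_real) (auto intro: continuous_on_subset)
  have "integral {0..a} g + integral {a..a + T} g = integral {0..a + T} g"
    using assms by (intro Henstock_Kurzweil_Integration.integral_combine int) auto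
  moreover have "integral {0..T} g + integral {T..a + T} g = integral {0..a + T} g"
    using assms by (intro Henstock_Kurzweil_Integration.integral_combine int) auto
  moreover have "integral {T..a + T} g = integral {0..a} g"
    using integral_shift_Icc_real[of 0 a g T] assms(2) by (simp add: o_def add.commute)
  ultimately show ?thesis by simp
qed

text \<open>Averaging over rotations by \<open>n\<close>-th roots of unity keeps the value at \<open>0\<close>, while on the circle the average
  tends uniformly to the mean; so the minimum principle suffices and no Poisson integral is needed.\<close>

lemma harmonic_supports_on_mean:
  assumes v: "harmonic_supports_on (ball 0 1) v" and r: "0 < r" "r < 1"
  shows "integral {0..2*pi} (\<lambda>\<theta>. v (of_real r * exp (\<i> * of_real \<theta>))) \<le> 2 * pi * v 0"
proof -
  define g where "g \<theta> = v (of_real r * exp (\<i> * of_real \<theta>))" for \<theta>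
  define I where "I = integral {0..2*pi} g"
  have contg: "continuous_on A g" for A
    unfolding g_def
  proof (rule continuous_on_compose2[where g = v and f = "\<lambda>\<theta>. of_real r * exp (\<i> * of_real \<theta>)"])
    show "continuous_on (ball 0 1) v" using v by (simp add: harmonic_supports_on_def)
    show "continuous_on A (\<lambda>\<theta>. of_real r * exp (\<i> * of_real \<theta>) :: complex)"
      by (intro continuous_intros)
  qed (use r in \<open>auto simp: norm_mult\<close>)
  have int: "g integrable_on {c..d}" for c d
    using contg by (intro integrable_continuous_real)
  have per: "g (t + 2 * pi) = g t" for t
    by (simp add: g_def exp_add ring_distribs mult.commute[of 2 "of_real pi :: complex"])
  have "I \<le> 2 * pi * v 0 + e" if "e > 0" for e
  proof -
    define e' where "e' = e / (2 * pi)"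
    have e': "e' > 0" using that by (simp add: e'_def)
    \<comment> \<open>Two periods, so as to contain every full turn starting at an angle in
      \<open>[0, 2 pi)\<close>.\<close>
    have "uniformly_continuous_on {0..4*pi} g"
      using contg by (intro compact_uniformly_continuous) auto
    then obtain d where d: "d > 0"
      "\<And>s t. s \<in> {0..4*pi} \<Longrightarrow> t \<in> {0..4*pi} \<Longrightarrow> dist t s < d \<Longrightarrow> dist (g t) (g s) < e'"
      using e' unfolding uniformly_continuous_on_def by metis
    obtain n :: nat where n: "2 * pi / d < real n" using reals_Archimedean2 by blast
    have n0: "real n > 0" using n d(1) pi_gt_zero
      by (smt (verit) divide_pos_pos)
    define h where "h = 2 * pi / real n"
    have h: "h > 0" "h < d" "real n * h = 2 * pi"
      using n n0 d(1) by (auto simp: h_def field_simps)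
    \<comment> \<open>The average over rotations, left undivided: \<open>V 0\<close> is
      \<open>n\<close> times \<open>v 0\<close>.\<close>
    define V where "V w = (\<Sum>k<n. v (w * exp (\<i> * of_real (real k * h))))" for w
    have V: "harmonic_supports_on (ball 0 1) V"
      unfolding V_def
    proof (rule harmonic_supports_on_sum[OF open_ball])
      show "harmonic_supports_on (ball 0 1) (\<lambda>w. v (w * exp (\<i> * of_real (real k * h))))" for k
        by (rule harmonic_supports_on_compose[OF v, where f = "\<lambda>w. w * exp (\<i> * of_real (real k * h))"])
           (auto simp: norm_mult intro: holomorphic_on_mult)
    qed
    \<comment> \<open>\<open>h * V w\<close> is a Riemann sum of \<open>g\<close> over one period
      with nodes starting at the argument of \<open>w\<close>. An error of at most \<open>e'\<close>
      per unit angle adds up to \<open>e\<close>, uniformly in \<open>w\<close>.\<close>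
    have low: "(I - e) / h \<le> V w" if w: "norm w = r" for w
    proof -
      define \<phi> where "\<phi> = Arg2pi w"
      have \<phi>: "0 \<le> \<phi>" "\<phi> < 2 * pi" "w = of_real r * exp (\<i> * of_real \<phi>)"
        using Arg2pi[of w] w by (simp_all add: \<phi>_def is_Arg_def)
      have Vg: "V w = (\<Sum>k<n. g (\<phi> + real k * h))"
        by (simp add: V_def \<phi>(3) g_def exp_add ring_distribs mult.assoc)
      have "I = integral {\<phi>..\<phi> + real n * h} g"
        using integral_periodic[OF contg per \<phi>(1)] h by (simp add: I_def)
      also have "\<dots> = (\<Sum>k<n. integral {\<phi> + real k * h..\<phi> + real (Suc k) * h} g)"
        by (rule integral_sum_adjacent[OF contg]) (use h in simp)
      also have "\<dots> \<le> (\<Sum>k<n. h * (g (\<phi> + real k * h) + e'))"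
      proof (rule sum_mono)
        fix k assume k: "k \<in> {..<n}"
        have kn: "real (Suc k) * h \<le> 2 * pi"
          using k h by (metis Suc_leI lessThan_iff mult_right_mono of_nat_le_iff less_imp_le)
        have "integral {\<phi> + real k * h..\<phi> + real (Suc k) * h} g
          \<le> integral {\<phi> + real k * h..\<phi> + real (Suc k) * h} (\<lambda>_. g (\<phi> + real k * h) + e')"
        proof (rule integral_le[OF int])
          fix t assume t: "t \<in> {\<phi> + real k * h..\<phi> + real (Suc k) * h}"
          have kh: "0 \<le> real k * h" "real (Suc k) * h = real k * h + h"
            using h by (simp_all add: algebra_simps)
          have "dist (g t) (g (\<phi> + real k * h)) < e'"
          proof (rule d(2))
            show "t \<in> {0..4*pi}" "\<phi> + real k * h \<in> {0..4*pi}" "dist t (\<phi> + real k * h) < d"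
              using t kn h(1,2) \<phi>(1,2) kh unfolding atLeastAtMost_iff dist_real_def by linarith+
          qed
          then show "g t \<le> g (\<phi> + real k * h) + e'" by (auto simp: dist_real_def)
        qed auto
        also have "\<dots> = h * (g (\<phi> + real k * h) + e')"
          using h by (simp add: algebra_simps)
        finally show "integral {\<phi> + real k * h..\<phi> + real (Suc k) * h} g \<le> h * (g (\<phi> + real k * h) + e')" .
      qed
      also have "\<dots> = h * V w + real n * h * e'"
        by (simp add: Vg sum_distrib_left[symmetric] sum.distrib algebra_simps)
      also have "real n * h * e' = e" by (simp add: h e'_def)
      finally show ?thesis using h by (simp add: field_simps)
    qed
    have "(I - e) / h \<le> V 0"
      by (rule harmonic_supports_on_minimum[OF V _ r(1) low]) (use r in auto)
    also have "V 0 = real n * v 0" by (simp add: V_def)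
    finally have "I - e \<le> real n * v 0 * h" using h(1) by (simp only: pos_divide_le_eq)
    also have "\<dots> = real n * h * v 0" by simp
    finally show ?thesis unfolding h(3) by simp
  qed
  then have "I \<le> 2 * pi * v 0" by (rule field_le_epsilon)
  then show ?thesis by (simp add: I_def g_def[abs_def])
qed

section \<open>The comb domain\<close>

text \<open>Compare real and imaginary parts in \<open>s^2 = 1 + z^2\<close>. If \<open>Re s\<close>
  were smaller in modulus than \<open>Re z\<close>, then \<open>Im s\<close> would be smaller in
  modulus than \<open>Im z\<close>, although the products of the two parts agree.\<close>

lemma abs_Re_le_Re_csqrt: "\<bar>Re z\<bar> \<le> Re (csqrt (1 + z\<^sup>2))"
proof (rule ccontr)
  define s where "s = csqrt (1 + z\<^sup>2)"
  assume "\<not> \<bar>Re z\<bar> \<le> Re (csqrt (1 + z\<^sup>2))"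
  then have less: "Re s < \<bar>Re z\<bar>" by (simp add: s_def)
  have nn: "0 \<le> Re s" unfolding s_def by (rule Re_csqrt)
  have "s\<^sup>2 = 1 + z\<^sup>2" by (simp add: s_def)
  then have "Re (s\<^sup>2) = Re (1 + z\<^sup>2)" "Im (s\<^sup>2) = Im (1 + z\<^sup>2)" by simp_all
  then have 1: "(Re s)\<^sup>2 - (Im s)\<^sup>2 = 1 + (Re z)\<^sup>2 - (Im z)\<^sup>2" and 2: "Re s * Im s = Re z * Im z"
    by (simp_all add: power2_eq_square mult.commute)
  have lt: "(Re s)\<^sup>2 < (Re z)\<^sup>2"
    using less nn by (metis power2_abs power_strict_mono zero_less_numeral)
  then have "(Im s)\<^sup>2 < (Im z)\<^sup>2" using 1 by linarith
  then have "(Re s)\<^sup>2 * (Im s)\<^sup>2 < (Re z)\<^sup>2 * (Im z)\<^sup>2"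
    using lt by (intro mult_strict_mono') auto
  then show False using 2 by (metis less_irrefl power_mult_distrib)
qed

text \<open>On the gate \<open>1 + z^2\<close> is a real number between 0 and 1.\<close>

lemma Re_csqrt_le_1:
  assumes "Re z = 0" "\<bar>Im z\<bar> \<le> 1"
  shows "Re (csqrt (1 + z\<^sup>2)) \<le> 1"
proof -
  have "z\<^sup>2 = of_real (- (Im z)\<^sup>2)"
    using assms(1) by (simp add: complex_eq_iff power2_eq_square)
  then have *: "1 + z\<^sup>2 = of_real (1 - (Im z)\<^sup>2)" by simp
  have "(Im z)\<^sup>2 \<le> 1" using assms(2) by (simp add: abs_square_le_1)
  then have "norm (1 + z\<^sup>2) \<le> 1" unfolding * norm_of_real by (simp add: abs_le_iff)
  then show ?thesis
    using complex_Re_le_cmod[of "csqrt (1 + z\<^sup>2)"] by simp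
qed

text \<open>The branch cut of \<open>csqrt\<close> is pulled back into the slits, so the root is
  holomorphic off them.\<close>

lemma one_plus_square_nonpos_Reals:
  assumes "1 + z\<^sup>2 \<in> \<real>\<^sub>\<le>\<^sub>0"
  shows "Re z = 0 \<and> \<bar>Im z\<bar> \<ge> 1"
proof -
  have 1: "1 + (Re z)\<^sup>2 - (Im z)\<^sup>2 \<le> 0" and 2: "Re z * Im z = 0"
    using assms by (auto simp: complex_nonpos_Reals_iff power2_eq_square)
  have "(Im z)\<^sup>2 \<ge> 1" using 1 zero_le_power2[of "Re z"] by linarith
  then have "\<bar>Im z\<bar> \<ge> 1" by (simp add: abs_le_square_iff[of 1, simplified])
  then show ?thesis using 2 by auto
qed

section \<open>Topology of the comb domain and its Riemann mapping\<close>

lemma mem_comb_domain: "z \<in> comb_domain x \<longleftrightarrow> Re z > - x 1 \<and> (\<forall>n. Re z = x n \<longrightarrow> \<bar>Im z\<bar> < 1)"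
proof -
  have "(\<exists>y. z = Complex (x n) y \<and> \<bar>y\<bar> \<ge> 1) \<longleftrightarrow> Re z = x n \<and> \<bar>Im z\<bar> \<ge> 1" for n
    by (cases z) auto
  then show ?thesis by (auto simp: comb_domain_def not_le)
qed

text \<open>As \<open>x\<close> diverges, only finitely many slits come near a given point, so
  locally a finite union of closed sets is removed.\<close>

lemma open_comb_domain:
  assumes x: "filterlim x at_top sequentially"
  shows "open (comb_domain x)"
proof -
  define K where "K n = {z. Re z = x n} \<inter> ({z. Im z \<le> -1} \<union> {z. 1 \<le> Im z})" for n
  have closed: "closed (K n)" for n
    unfolding K_def by (intro closed_Int closed_Un closed_halfspace_Re_eq closed_halfspace_Im_le closed_halfspace_Im_ge)
  have "\<exists>T. open T \<and> z \<in> T \<and> T \<subseteq> comb_domain x" if z: "z \<in> comb_domain x" for z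
  proof -
    have "eventually (\<lambda>n. x n \<ge> Re z + 1) sequentially"
      using x by (simp add: filterlim_at_top)
    then obtain N where N: "\<And>n. n \<ge> N \<Longrightarrow> x n \<ge> Re z + 1"
      by (auto simp: eventually_sequentially)
    define T where "T = {w. - x 1 < Re w} \<inter> {w. Re w < Re z + 1} - (\<Union>n<N. K n)"
    have "open T"
      unfolding T_def using closed
      by (intro open_Diff open_Int open_halfspace_Re_gt open_halfspace_Re_lt closed_UN) auto
    moreover have "z \<in> T" using z by (fastforce simp: T_def K_def mem_comb_domain)
    moreover have "T \<subseteq> comb_domain x"
    proof
      fix w assume w: "w \<in> T"
      have "\<bar>Im w\<bar> < 1" if "Re w = x n" for n
      proof -
        have "n < N" using N[of n] w that by (force simp: T_def)
        then show ?thesis using w that by (auto simp: T_def K_def)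
      qed
      then show "w \<in> comb_domain x" using w by (auto simp: mem_comb_domain T_def)
    qed
    ultimately show ?thesis by blast
  qed
  then show ?thesis by (simp add: open_subopen[of "comb_domain x"])
qed

text \<open>A straight segment to 0 may cross a slit. Hence the domain is first flattened vertically
  onto the real axis, which fixes \<open>Re\<close> and shrinks the modulus of \<open>Im\<close>,
  and then contracted to 0 along the axis.\<close>

lemma contractible_comb_domain:
  assumes "x 0 = 0" "x 1 > 0"
  shows "contractible (comb_domain x)"
proof -
  let ?S = "comb_domain x"
  have 1: "homotopic_with_canon (\<lambda>_. True) ?S ?S id (\<lambda>z. of_real (Re z))"
  proof (rule homotopic_with_linear)
    fix z assume z: "z \<in> ?S"
    show "closed_segment (id z) (of_real (Re z)) \<subseteq> ?S"
    proof
      fix w assume "w \<in> closed_segment (id z) (of_real (Re z))"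
      then obtain t where t: "0 \<le> t" "t \<le> 1" "w = (1 - t) *\<^sub>R z + t *\<^sub>R of_real (Re z)"
        by (auto simp: in_segment)
      have "Re w = Re z" "Im w = (1 - t) * Im z" unfolding t(3) by (simp_all add: algebra_simps)
      moreover have "\<bar>(1 - t) * Im z\<bar> \<le> 1 * \<bar>Im z\<bar>"
        unfolding abs_mult using t by (intro mult_right_mono) auto
      ultimately show "w \<in> ?S" using z by (force simp: mem_comb_domain)
    qed
  qed (auto intro!: continuous_intros)
  have 2: "homotopic_with_canon (\<lambda>_. True) ?S ?S (\<lambda>z. of_real (Re z)) (\<lambda>_. 0)"
  proof (rule homotopic_with_linear)
    fix z assume z: "z \<in> ?S"
    show "closed_segment (of_real (Re z)) (0 :: complex) \<subseteq> ?S"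
    proof
      fix w assume "w \<in> closed_segment (of_real (Re z)) (0 :: complex)"
      then obtain t where t: "0 \<le> t" "t \<le> 1" "w = (1 - t) *\<^sub>R of_real (Re z) + t *\<^sub>R 0"
        by (auto simp: in_segment)
      then have "w = of_real ((1 - t) * Re z)" by (simp add: scaleR_conv_of_real)
      moreover have "(1 - t) * Re z > - x 1"
      proof (cases "Re z \<ge> 0")
        case True
        then have "(1 - t) * Re z \<ge> 0" using t by simp
        then show ?thesis using assms(2) by linarith
      next
        case False
        then have "(1 - t) * Re z \<ge> 1 * Re z" using t by (intro mult_right_mono_neg) auto
        then show ?thesis using z by (simp add: mem_comb_domain)
      qed
      ultimately show "w \<in> ?S" by (simp add: mem_comb_domain)
    qed
  qed (auto intro!: continuous_intros)
  show ?thesis unfolding contractible_def using homotopic_with_trans[OF 1 2] by blast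
qed

lemma riemann_mapping_comb_domain:
  assumes "x 0 = 0" "x 1 > 0" "filterlim x at_top sequentially"
  shows "\<exists>f. riemann_mapping f (comb_domain x)"
proof -
  let ?S = "comb_domain x"
  have "0 \<in> ?S" "of_real (- x 1) \<notin> ?S" using assms(1,2) by (simp_all add: mem_comb_domain)
  then have ne: "?S \<noteq> {}" "?S \<noteq> UNIV" by blast+
  have "open ?S \<and> simply_connected ?S"
    using open_comb_domain contractible_comb_domain contractible_imp_simply_connected assms by blast
  then obtain f g where fg: "g holomorphic_on ball 0 1" "\<forall>z\<in>?S. f z \<in> ball 0 1 \<and> g (f z) = z"
    "\<forall>z\<in>ball 0 1. g z \<in> ?S \<and> f (g z) = z"
    using ne unfolding Riemann_mapping_theorem by blast
  then have "bij_betw g (ball 0 1) ?S"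
    by (intro bij_betw_byWitness[where f' = f]) auto
  then show ?thesis using fg(1) unfolding riemann_mapping_def by blast
qed

section \<open>The glued superharmonic potential\<close>

text \<open>The two conditions on \<open>c\<close> force \<delta> > 1.\<close>

locale gapped_comb =
  fixes x :: "nat \<Rightarrow> real" and \<delta> c :: real
  assumes x0: "x 0 = 0"
    and x_lim: "filterlim x at_top sequentially"
    and gap: "\<And>n. x n + \<delta> \<le> x (Suc n)"
    and c_ge: "1 \<le> c"
    and c_less: "2 * c < 1 + \<delta>"
begin

text \<open>The real part is the function \<open>W n\<close> of the overview; the complex version
  keeps it visibly harmonic.\<close>

definition gate :: "nat \<Rightarrow> complex \<Rightarrow> complex" where
  "gate n z = of_real (c ^ n) * (1 + csqrt (1 + (z - of_real (x n))\<^sup>2))"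

text \<open>The strict inequality puts the line over \<open>x n\<close> into the cell to its right:
  for \<open>x n \<le> Re z < x (n + 1)\<close> the index is \<open>n + 1\<close>.\<close>

definition index :: "complex \<Rightarrow> nat" where
  "index z = (LEAST n. Re z < x n)"

definition potential :: "complex \<Rightarrow> real" where
  "potential z = min (Re (gate (index z) z)) (Re (gate (index z - 1) z))"

lemma x_less_Suc: "x n < x (Suc n)"
  using gap[of n] c_ge c_less by linarith

lemma strict_mono_x: "strict_mono x"
  using x_less_Suc by (simp add: strict_mono_Suc_iff)

lemma gate_lower: "c ^ n * (1 + \<bar>Re z - x n\<bar>) \<le> Re (gate n z)"
proof -
  have "Re (gate n z) = c ^ n * (1 + Re (csqrt (1 + (z - of_real (x n))\<^sup>2)))"
    by (simp add: gate_def)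
  then show ?thesis
    using c_ge abs_Re_le_Re_csqrt[of "z - of_real (x n)"] by (simp add: mult_left_mono)
qed

lemma gate_upper:
  assumes "Re z = x n" "\<bar>Im z\<bar> \<le> 1"
  shows "Re (gate n z) \<le> 2 * c ^ n"
proof -
  have "Re (gate n z) = c ^ n * (1 + Re (csqrt (1 + (z - of_real (x n))\<^sup>2)))"
    by (simp add: gate_def)
  also have "\<dots> \<le> c ^ n * 2"
    using c_ge Re_csqrt_le_1[of "z - of_real (x n)"] assms by (intro mult_left_mono) auto
  finally show ?thesis by simp
qed

lemma gate_holomorphic: "gate n holomorphic_on comb_domain x"
proof -
  have "1 + (z - of_real (x n))\<^sup>2 \<notin> \<real>\<^sub>\<le>\<^sub>0" if "z \<in> comb_domain x" for z
    using one_plus_square_nonpos_Reals[of "z - of_real (x n)"] that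
    by (auto simp: mem_comb_domain)
  then show ?thesis
    unfolding gate_def by (intro holomorphic_intros) auto
qed

lemma ex_Re_less_x: "\<exists>n. Re z < x n"
  using x_lim by (auto simp: filterlim_at_top_dense eventually_sequentially)

lemma Re_less_x_index: "Re z < x (index z)"
  unfolding index_def by (rule LeastI_ex[OF ex_Re_less_x])

lemma x_le_Re: "k < index z \<Longrightarrow> x k \<le> Re z"
  unfolding index_def using not_less_Least not_less by blast

lemma index_eqI:
  assumes "Re z < x n" "n \<noteq> 0 \<Longrightarrow> x (n - 1) \<le> Re z"
  shows "index z = n"
  unfolding index_def
proof (rule Least_equality)
  fix k assume k: "Re z < x k"
  show "n \<le> k"
  proof (rule ccontr)
    assume "\<not> n \<le> k"
    then have "x k \<le> x (n - 1)" "n \<noteq> 0"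
      using strict_mono_x by (auto simp: strict_mono_less_eq)
    then show False using assms(2) k by simp
  qed
qed (rule assms(1))

text \<open>In the leftmost cell \<open>index z = 0\<close>, and truncated subtraction makes the potential \<open>gate 0\<close> there.\<close>

lemma potential_lower: "c ^ (index z - 1) \<le> potential z"
proof -
  have *: "c ^ n \<le> Re (gate n z)" for n
  proof -
    have "c ^ n * 1 \<le> c ^ n * (1 + \<bar>Re z - x n\<bar>)" using c_ge by (intro mult_left_mono) auto
    then show ?thesis using gate_lower[of n z] by simp
  qed
  have "c ^ (index z - 1) \<le> c ^ index z" using c_ge by (intro power_increasing) auto
  then show ?thesis using *[of "index z"] *[of "index z - 1"] by (simp add: potential_def)
qed

text \<open>The left side is at most \<open>2 * c ^ n\<close>. The next pair of slits is at distance
  at least \<delta> and has the larger weight, so the right side is at least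
  \<open>c ^ n * (1 + \<delta>)\<close>.\<close>

lemma gate_less_Suc:
  assumes "Re z = x n" "\<bar>Im z\<bar> \<le> 1"
  shows "Re (gate n z) < Re (gate (Suc n) z)"
proof -
  have "2 * c ^ n < c ^ n * (1 + \<delta>)" using c_ge c_less by simp
  also have "\<dots> \<le> c ^ Suc n * (1 + \<bar>Re z - x (Suc n)\<bar>)"
    using c_ge c_less gap[of n] assms(1) by (intro mult_mono power_increasing) auto
  also have "\<dots> \<le> Re (gate (Suc n) z)" by (rule gate_lower)
  finally show ?thesis using gate_upper[OF assms] by linarith
qed

text \<open>Here the neighbour has the smaller weight, and the distance \<delta> must make up for a
  factor \<open>c\<close>: this is where \<open>2 * c < 1 + \<delta>\<close> is needed in
  full.\<close>

lemma gate_Suc_less: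
  assumes "Re z = x (Suc n)" "\<bar>Im z\<bar> \<le> 1"
  shows "Re (gate (Suc n) z) < Re (gate n z)"
proof -
  have "2 * c ^ Suc n = c ^ n * (2 * c)" by simp
  also have "\<dots> < c ^ n * (1 + \<delta>)" using c_ge c_less by simp
  also have "\<dots> \<le> c ^ n * (1 + \<bar>Re z - x n\<bar>)"
    using c_ge gap[of n] assms(1) by (intro mult_left_mono) auto
  also have "\<dots> \<le> Re (gate n z)" by (rule gate_lower)
  finally show ?thesis using gate_upper[OF assms] by linarith
qed

lemma open_gate_less: "open {z \<in> comb_domain x. Re (gate m z) < Re (gate n z)}"
proof -
  have "continuous_on (comb_domain x) (\<lambda>z. Re (gate n z) - Re (gate m z))"
    by (intro continuous_on_diff continuous_on_Re holomorphic_on_imp_continuous_on gate_holomorphic)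
  from continuous_open_preimage[OF this open_comb_domain[OF x_lim] open_greaterThan[of 0]]
  show ?thesis by (simp add: vimage_def Int_def)
qed

text \<open>Inside a cell this is the definition. Across a gate the defining formula changes, but
  the strict inequalities on the gate persist nearby and reduce both formulas to the same
  \<open>gate n\<close>.\<close>

lemma potential_local:
  assumes z: "z \<in> comb_domain x"
  shows "\<exists>N i j. open N \<and> z \<in> N \<and> N \<subseteq> comb_domain x \<and>
     (\<forall>y\<in>N. potential y = min (Re (gate i y)) (Re (gate j y)))"
proof -
  define k where "k = index z"
  have open_cell: "open {y \<in> comb_domain x. Re y < x m \<and> (n \<noteq> 0 \<longrightarrow> x (n - 1) < Re y)}" for m n
  proof -
    have "{y \<in> comb_domain x. Re y < x m \<and> (n \<noteq> 0 \<longrightarrow> x (n - 1) < Re y)}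
      = comb_domain x \<inter> {y. Re y < x m} \<inter> (if n = 0 then UNIV else {y. x (n - 1) < Re y})"
      by auto
    then show ?thesis
      by (simp add: open_Int open_comb_domain[OF x_lim] open_halfspace_Re_lt open_halfspace_Re_gt)
  qed
  show ?thesis
  proof (cases "k \<noteq> 0 \<and> Re z = x (k - 1)")
    case False
    let ?N = "{y \<in> comb_domain x. Re y < x k \<and> (k \<noteq> 0 \<longrightarrow> x (k - 1) < Re y)}"
    have "z \<in> ?N"
      using z False Re_less_x_index[of z] x_le_Re[of "k - 1" z] by (force simp: k_def)
    moreover have "potential y = min (Re (gate k y)) (Re (gate (k - 1) y))" if "y \<in> ?N" for y
      using index_eqI[of y k] that by (auto simp: potential_def)
    ultimately show ?thesis using open_cell
      by (intro exI[of _ ?N] exI[of _ k] exI[of _ "k - 1"]) auto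
  next
    case True
    then obtain n where n: "k = Suc n" "Re z = x n" by (cases k) auto
    \<comment> \<open>On \<open>?A\<close> the formula right of the gate reduces to
      \<open>gate n\<close>, on \<open>?B\<close> the one left of it. For \<open>n = 0\<close> the
      left formula is \<open>gate 0\<close> already, so \<open>?B\<close> imposes nothing.\<close>
    let ?A = "{y \<in> comb_domain x. Re (gate n y) < Re (gate (Suc n) y)}"
    let ?B = "if n = 0 then comb_domain x else {y \<in> comb_domain x. Re (gate n y) < Re (gate (n - 1) y)}"
    let ?N = "{y \<in> comb_domain x. Re y < x (Suc n) \<and> (n \<noteq> 0 \<longrightarrow> x (n - 1) < Re y)} \<inter> ?A \<inter> ?B"
    have im: "\<bar>Im z\<bar> \<le> 1" using z n(2) by (force simp: mem_comb_domain)
    have "open ?N"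
      by (intro open_Int open_cell open_gate_less) (simp add: open_gate_less open_comb_domain[OF x_lim])
    moreover have "z \<in> ?N"
    proof (cases n)
      case 0
      then show ?thesis using z n gate_less_Suc[OF n(2) im] x_less_Suc by auto
    next
      case (Suc l)
      then show ?thesis
        using z n gate_less_Suc[OF n(2) im] gate_Suc_less[of z l] im x_less_Suc by auto
    qed
    moreover have "potential y = Re (gate n y)" if "y \<in> ?N" for y
    proof (cases "Re y < x n")
      case True
      then have "index y = n" using that by (intro index_eqI) auto
      then show ?thesis using that by (auto simp: potential_def split: if_splits)
    next
      case False
      then have "index y = Suc n" using that by (intro index_eqI) auto
      then show ?thesis using that by (auto simp: potential_def)
    qed
    ultimately show ?thesis
      by (intro exI[of _ ?N] exI[of _ n]) auto
  qed
qed

lemma potential_harmonic_supports: "harmonic_supports_on (comb_domain x) potential"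
proof (rule harmonic_supports_on_local_min)
  fix z assume "z \<in> comb_domain x"
  from potential_local[OF this] obtain N i j where N: "open N" "z \<in> N" "N \<subseteq> comb_domain x"
    "\<forall>y\<in>N. potential y = min (Re (gate i y)) (Re (gate j y))"
    by (elim exE conjE)
  then have "gate n holomorphic_on N" for n
    by (intro holomorphic_on_subset[OF gate_holomorphic])
  with N show "\<exists>N G H. open N \<and> z \<in> N \<and> N \<subseteq> comb_domain x \<and> G holomorphic_on N \<and> H holomorphic_on N
     \<and> (\<forall>y\<in>N. potential y = min (Re (G y)) (Re (H y)))"
    by (intro exI[of _ N] exI[of _ "gate i"] exI[of _ "gate j"]) simp
qed

lemma abs_Re_power_le_potential:
  assumes z: "z \<in> comb_domain x" and C: "\<And>n. x (Suc n) ^ p \<le> C * c ^ n"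
  shows "\<bar>Re z\<bar> ^ p \<le> C * potential z"
proof -
  \<comment> \<open>The shifted index differs from \<open>index z\<close> only in the leftmost cell,
    where it is 1 and the bound comes from the boundary line \<open>Re z = - x 1\<close>.\<close>
  have "\<bar>Re z\<bar> \<le> x (Suc (index z - 1))"
  proof (cases "index z")
    case 0
    then show ?thesis using Re_less_x_index[of z] z x0 by (auto simp: mem_comb_domain)
  next
    case (Suc n)
    then show ?thesis using Re_less_x_index[of z] x_le_Re[of 0 z] x0 by simp
  qed
  then have "\<bar>Re z\<bar> ^ p \<le> x (Suc (index z - 1)) ^ p" by (intro power_mono) auto
  also have "\<dots> \<le> C * c ^ (index z - 1)" by (rule C)
  also have "\<dots> \<le> C * potential z"
  proof -
    have "0 \<le> x 1 ^ p" using x_less_Suc[of 0] x0 by simp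
    then have "0 \<le> C" using C[of 0] by simp
    then show ?thesis by (intro mult_left_mono potential_lower)
  qed
  finally show ?thesis .
qed

end

section \<open>Bounding the Hardy means\<close>

text \<open>Factor out \<open>z - w\<close>; each of the \<open>k\<close> remaining terms is at most
  \<open>norm z ^ (k - 1)\<close>.\<close>

lemma norm_power_diff_le:
  fixes z w :: complex
  assumes "norm w \<le> norm z"
  shows "norm (z ^ k - w ^ k) \<le> real k * norm (z - w) * norm z ^ (k - 1)"
proof -
  have "norm (\<Sum>i<k. w ^ (k - Suc i) * z ^ i) \<le> (\<Sum>i<k. norm z ^ (k - 1))"
  proof (rule sum_norm_le)
    fix i assume i: "i \<in> {..<k}"
    then have "norm (w ^ (k - Suc i) * z ^ i) \<le> norm z ^ (k - Suc i) * norm z ^ i"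
      unfolding norm_mult norm_power by (intro mult_right_mono power_mono assms) auto
    also have "\<dots> = norm z ^ (k - 1)" using i by (simp flip: power_add)
    finally show "norm (w ^ (k - Suc i) * z ^ i) \<le> norm z ^ (k - 1)" .
  qed
  then have "norm (z - w) * norm (\<Sum>i<k. w ^ (k - Suc i) * z ^ i) \<le> norm (z - w) * (real k * norm z ^ (k - 1))"
    by (intro mult_left_mono) auto
  then show ?thesis
    unfolding power_diff_sumr2[of z k w] norm_mult by (simp only: mult_ac)
qed

text \<open>Near the real axis \<open>Re (w ^ k)\<close> is comparable to \<open>norm w ^ k\<close>, and elsewhere \<open>Im w\<close> is comparable to \<open>norm w\<close>.\<close>

lemma norm_power_le_Im_Re_power:
  fixes w :: complex
  assumes "even k" "k > 0"
  shows "norm w ^ k \<le> 3 * (4 * real k) ^ k * \<bar>Im w\<bar> ^ k + 2 * Re (w ^ k)"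
proof (cases "4 * real k * \<bar>Im w\<bar> \<le> norm w")
  case True
  have "norm (w ^ k - of_real (Re w) ^ k) \<le> real k * norm (w - of_real (Re w)) * norm w ^ (k - 1)"
    by (rule norm_power_diff_le) (simp add: abs_Re_le_cmod)
  also have "norm (w - of_real (Re w)) = \<bar>Im w\<bar>"
    by (simp add: cmod_eq_Im)
  also have "real k * \<bar>Im w\<bar> * norm w ^ (k - 1) \<le> norm w / 4 * norm w ^ (k - 1)"
    using True by (intro mult_right_mono) auto
  also have "\<dots> = norm w ^ k / 4" using assms(2) by (cases k) auto
  finally have d: "norm (w ^ k - of_real (Re w) ^ k) \<le> norm w ^ k / 4" .
  have "norm (w ^ k) \<le> norm (w ^ k - of_real (Re w) ^ k) + norm (of_real (Re w) ^ k :: complex)"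
    using norm_triangle_ineq[of "w ^ k - of_real (Re w) ^ k" "of_real (Re w) ^ k"] by simp
  moreover have "norm (of_real (Re w) ^ k :: complex) = Re w ^ k"
    using assms(1) by (simp add: norm_power power_even_abs)
  moreover have "Re w ^ k - Re (w ^ k) \<le> norm (w ^ k - of_real (Re w) ^ k)"
    using abs_Re_le_cmod[of "w ^ k - of_real (Re w) ^ k"] by (simp flip: of_real_power)
  \<comment> \<open>The factor 4 in the case split makes the error \<open>d\<close> a quarter of
    \<open>norm w ^ k\<close>. It enters twice, and half of \<open>norm w ^ k\<close> is
    left.\<close>
  ultimately have "norm w ^ k \<le> 2 * Re (w ^ k)" using d by (simp add: norm_power)
  moreover have "0 \<le> 3 * (4 * real k) ^ k * \<bar>Im w\<bar> ^ k" by simp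
  ultimately show ?thesis by linarith
next
  case False
  \<comment> \<open>The constant 3 pays once for \<open>norm w ^ k\<close> and twice for a possibly
    negative \<open>Re (w ^ k)\<close>.\<close>
  then have "norm w ^ k \<le> (4 * real k * \<bar>Im w\<bar>) ^ k" by (intro power_mono) auto
  moreover have "- Re (w ^ k) \<le> norm w ^ k"
    using abs_Re_le_cmod[of "w ^ k"] by (simp add: norm_power)
  ultimately show ?thesis by (simp add: power_mult_distrib)
qed

text \<open>Multiplication by \<open>\<i>\<close> turns the real part into the imaginary
  part.\<close>

lemma norm_power_le_Re_power:
  fixes z :: complex
  assumes "m > 0"
  shows "norm z ^ (2 * m) \<le> 3 * (8 * real m) ^ (2 * m) * \<bar>Re z\<bar> ^ (2 * m) + 2 * Re ((\<i> * z) ^ (2 * m))"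
  using norm_power_le_Im_Re_power[of "2 * m" "\<i> * z"] assms by (simp add: norm_mult)

section \<open>Growth of the slit positions\<close>

text \<open>The increments are eventually at most \<open>\<mu> ^ n\<close>, and so a geometric sum
  bounds \<open>x\<close>.\<close>

lemma subexponential_partial_sums:
  fixes x \<alpha> :: "nat \<Rightarrow> real"
  assumes "mono x" and \<alpha>: "\<And>n. \<alpha> (Suc n) = x (Suc n) - x n" "\<And>n. \<alpha> (Suc n) > 0"
    and lim: "(\<lambda>n. ln (\<alpha> n) / real n) \<longlonglongrightarrow> 0" and "\<mu> > 1"
  shows "\<exists>K. \<forall>n. x n \<le> K * \<mu> ^ n"
proof -
  have "eventually (\<lambda>n. ln (\<alpha> n) / real n < ln \<mu>) sequentially"
    using lim \<open>\<mu> > 1\<close> by (intro order_tendstoD(2)) auto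
  then obtain n0 where n0: "\<And>n. n \<ge> n0 \<Longrightarrow> ln (\<alpha> n) / real n < ln \<mu>"
    by (auto simp: eventually_sequentially)
  have \<alpha>_le: "\<alpha> (Suc n) \<le> \<mu> ^ Suc n" if "n \<ge> n0" for n
  proof -
    have "ln (\<alpha> (Suc n)) < real (Suc n) * ln \<mu>"
      using n0[of "Suc n"] that by (simp add: field_simps)
    also have "\<dots> = ln (\<mu> ^ Suc n)" using \<open>\<mu> > 1\<close> by (subst ln_realpow) auto
    finally show ?thesis using \<alpha>(2)[of n] \<open>\<mu> > 1\<close> by (subst (asm) ln_less_cancel_iff) auto
  qed
  \<comment> \<open>The first bound covers all indices up to \<open>n0\<close> by monotonicity; the
    second gives \<open>K + \<mu> \<le> K * \<mu>\<close>, which closes the induction step.\<close>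
  define K where "K = max (x n0) (\<mu> / (\<mu> - 1))"
  have K: "K \<ge> x n0" "K \<ge> \<mu> / (\<mu> - 1)" by (simp_all add: K_def)
  have K0: "K \<ge> 0" using K(2) \<open>\<mu> > 1\<close> by (smt (verit) divide_nonneg_nonneg)
  have K1: "\<mu> \<le> K * (\<mu> - 1)" using K(2) \<open>\<mu> > 1\<close> by (simp add: pos_divide_le_eq)
  have pow: "\<mu> ^ n \<ge> 1" for n using \<open>\<mu> > 1\<close> by simp
  have small: "x n \<le> K * \<mu> ^ n" if "n \<le> n0" for n
  proof -
    have "x n \<le> K" using monoD[OF \<open>mono x\<close> that] K(1) by simp
    also have "\<dots> \<le> K * \<mu> ^ n" using K0 pow[of n] mult_left_mono[of 1 "\<mu> ^ n" K] by simp
    finally show ?thesis .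
  qed
  have "x n \<le> K * \<mu> ^ n" for n
  proof (induction n)
    case 0
    show ?case by (rule small) simp
  next
    case (Suc n)
    show ?case
    proof (cases "Suc n \<le> n0")
      case False
      then have "x (Suc n) \<le> K * \<mu> ^ n + \<mu> ^ Suc n" using Suc \<alpha>_le[of n] \<alpha>(1)[of n] by simp
      also have "\<dots> = (K + \<mu>) * \<mu> ^ n" by (simp add: algebra_simps)
      also have "\<dots> \<le> (K * \<mu>) * \<mu> ^ n"
        using K1 \<open>\<mu> > 1\<close> by (intro mult_right_mono) (auto simp: algebra_simps)
      finally show ?thesis by (simp add: algebra_simps)
    qed (rule small)
  qed
  then show ?thesis by blast
qed

section \<open>From majorants to Hardy spaces\<close>

text \<open>Every circle mean is at most that of \<open>v\<close>, hence at most
  \<open>2 * pi * v 0\<close>, which does not depend on the radius.\<close>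

lemma hardy_space_if_harmonic_supports:
  assumes f: "f holomorphic_on ball 0 1" and p: "p > 0"
    and v: "harmonic_supports_on (ball 0 1) v"
    and le: "\<And>w. w \<in> ball 0 1 \<Longrightarrow> norm (f w) powr p \<le> v w"
  shows "f \<in> hardy_space p"
proof -
  have "integral {0..2*pi} (\<lambda>\<theta>. norm (f (of_real r * exp (\<i> * of_real \<theta>))) powr p) \<le> 2 * pi * v 0"
    if r: "r \<in> {0<..<1}" for r
  proof -
    have circ: "(\<lambda>\<theta>. of_real r * exp (\<i> * of_real \<theta>)) ` {0..2*pi} \<subseteq> ball (0::complex) 1"
      using r by (auto simp: norm_mult)
    have cc: "continuous_on {0..2*pi} (\<lambda>\<theta>. of_real r * exp (\<i> * of_real \<theta>) :: complex)"
      by (intro continuous_intros)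
    have "continuous_on {0..2*pi} (\<lambda>\<theta>. f (of_real r * exp (\<i> * of_real \<theta>)))"
      by (rule continuous_on_compose2[OF holomorphic_on_imp_continuous_on[OF f] cc circ])
    then have 1: "continuous_on {0..2*pi} (\<lambda>\<theta>. norm (f (of_real r * exp (\<i> * of_real \<theta>))) powr p)"
      using p by (intro continuous_on_powr' continuous_on_norm continuous_on_const) auto
    have "continuous_on (ball 0 1) v" using v by (simp add: harmonic_supports_on_def)
    then have 2: "continuous_on {0..2*pi} (\<lambda>\<theta>. v (of_real r * exp (\<i> * of_real \<theta>)))"
      by (rule continuous_on_compose2[OF _ cc circ])
    have "integral {0..2*pi} (\<lambda>\<theta>. norm (f (of_real r * exp (\<i> * of_real \<theta>))) powr p)
      \<le> integral {0..2*pi} (\<lambda>\<theta>. v (of_real r * exp (\<i> * of_real \<theta>)))"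
      using circ by (intro integral_le integrable_continuous_real 1 2 le) blast
    also have "\<dots> \<le> 2 * pi * v 0" using r by (intro harmonic_supports_on_mean[OF v]) auto
    finally show ?thesis .
  qed
  then show ?thesis using f unfolding hardy_space_def by (auto intro!: bdd_aboveI2[where M = "2 * pi * v 0"])
qed

lemma (in gapped_comb) riemann_mapping_hardy_space:
  assumes f: "riemann_mapping f (comb_domain x)" and "m > 0"
    and C: "\<And>n. x (Suc n) ^ (2 * m) \<le> C * c ^ n"
  shows "f \<in> hardy_space (real (2 * m))"
proof -
  define A where "A = 3 * (8 * real m) ^ (2 * m)"
  have hol: "f holomorphic_on ball 0 1" and img: "f ` ball 0 1 = comb_domain x"
    using f by (auto simp: riemann_mapping_def bij_betw_def)
  have "0 \<le> x (Suc 0) ^ (2 * m)" by (rule zero_le_even_power) simp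
  also have "\<dots> \<le> C" using C[of 0] by simp
  finally have "C \<ge> 0" .
  \<comment> \<open>The majorant: the potential term dominates the power of \<open>Re (f w)\<close>,
    and the other term is harmonic.\<close>
  have "harmonic_supports_on (ball 0 1) (\<lambda>w. A * C * potential (f w) + Re (2 * (\<i> * f w) ^ (2 * m)))"
  proof (intro harmonic_supports_on_add harmonic_supports_on_cmult harmonic_supports_on_Re)
    show "harmonic_supports_on (ball 0 1) (\<lambda>w. potential (f w))"
      using potential_harmonic_supports hol img by (auto intro: harmonic_supports_on_compose)
    show "(\<lambda>w. 2 * (\<i> * f w) ^ (2 * m)) holomorphic_on ball 0 1"
      by (intro holomorphic_intros hol)
  qed (use \<open>C \<ge> 0\<close> in \<open>auto simp: A_def\<close>)
  then show ?thesis
  proof (rule hardy_space_if_harmonic_supports[OF hol, rotated])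
    fix w :: complex assume "w \<in> ball 0 1"
    then have "\<bar>Re (f w)\<bar> ^ (2 * m) \<le> C * potential (f w)"
      using img by (intro abs_Re_power_le_potential C) auto
    then have "A * \<bar>Re (f w)\<bar> ^ (2 * m) \<le> A * (C * potential (f w))"
      by (intro mult_left_mono) (auto simp: A_def)
    moreover have "norm (f w) powr real (2 * m) = norm (f w) ^ (2 * m)"
      using \<open>m > 0\<close> by (intro powr_realpow') auto
    ultimately show "norm (f w) powr real (2 * m) \<le> A * C * potential (f w) + Re (2 * (\<i> * f w) ^ (2 * m))"
      using norm_power_le_Re_power[OF \<open>m > 0\<close>, of "f w"] unfolding A_def[symmetric]
      by (simp add: mult.assoc)
  qed (use \<open>m > 0\<close> in auto)
qed

theorem theorem1p2:
  fixes x \<alpha> :: "nat \<Rightarrow> real"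
  assumes "x 0 = 0"
    and "strict_mono_on {1..} x"
    and "\<And>n. n \<ge> 1 \<Longrightarrow> x n > 0"
    and "filterlim x at_top sequentially"
    and "(INF n\<in>{1..}. x n - x (n - 1)) > 1"
    and "\<And>n. n \<ge> 1 \<Longrightarrow> \<alpha> n = x n - x (n - 1)"
    and "(\<lambda>n. ln (\<alpha> n) / real n) \<longlonglongrightarrow> 0"
  shows "hardy_number (comb_domain x) = \<infinity>"
proof -
  define \<delta> where "\<delta> = (INF n\<in>{1..}. x n - x (n - 1))"
  \<comment> \<open>The midpoint of 1 and \<open>(1 + \<delta>) / 2\<close>.\<close>
  define c where "c = (3 + \<delta>) / 4"
  have \<delta>: "\<delta> > 1" using assms(5) by (simp add: \<delta>_def)
  have c: "c > 1" "2 * c < 1 + \<delta>" using \<delta> by (auto simp: c_def field_simps)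
  have "0 \<le> x n - x (n - 1)" if "n \<in> {1..}" for n
  \<comment> \<open>Monotonicity is assumed from index 1 on, so the first gap uses positivity of
    \<open>x 1\<close>.\<close>
  proof (cases "n = 1")
    case True
    then show ?thesis using assms(1) assms(3)[of 1] by simp
  next
    case False
    then have "n - 1 \<in> {1..}" "n - 1 < n" using that by auto
    then show ?thesis using strict_mono_onD[OF assms(2), of "n - 1" n] that by simp
  qed
  then have bdd: "bdd_below ((\<lambda>n. x n - x (n - 1)) ` {1..})" by (rule bdd_belowI2)
  have gap: "x n + \<delta> \<le> x (Suc n)" for n
  proof -
    have "\<delta> \<le> x (Suc n) - x (Suc n - 1)"
      unfolding \<delta>_def by (rule cINF_lower[OF bdd]) simp
    then show ?thesis by simp
  qed
  interpret gapped_comb x \<delta> c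
    using assms(1,4) gap less_imp_le[OF c(1)] c(2) by (rule gapped_comb.intro)
  define f where "f = (SOME f. riemann_mapping f (comb_domain x))"
  have f: "riemann_mapping f (comb_domain x)"
    unfolding f_def
    by (rule someI_ex[OF riemann_mapping_comb_domain[OF assms(1) _ assms(4)]]) (simp add: assms(3))
  have mem: "f \<in> hardy_space (real (2 * m))" if m: "m > 0" for m
  proof -
    \<comment> \<open>With this root, the power \<open>2 * m\<close> of a bound
      \<open>K * \<mu> ^ n\<close> grows exactly like \<open>c ^ n\<close>.\<close>
    define \<mu> where "\<mu> = root (2 * m) c"
    have \<mu>: "\<mu> > 1" "\<mu> ^ (2 * m) = c" using c(1) m by (auto simp: \<mu>_def)
    have "\<exists>K. \<forall>n. x n \<le> K * \<mu> ^ n"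
    proof (rule subexponential_partial_sums)
      show "mono x" using strict_mono_x by (rule strict_mono_mono)
      show "\<alpha> (Suc n) = x (Suc n) - x n" for n using assms(6)[of "Suc n"] by simp
      then show "\<alpha> (Suc n) > 0" for n using x_less_Suc[of n] by simp
    qed (use assms(7) \<mu> in auto)
    then obtain K where K: "\<And>n. x n \<le> K * \<mu> ^ n" by blast
    show ?thesis
    proof (rule riemann_mapping_hardy_space[OF f m])
      fix n
      have "x (Suc n) ^ (2 * m) \<le> (K * \<mu> ^ Suc n) ^ (2 * m)"
        using assms(3)[of "Suc n"] by (intro power_mono K) auto
      also have "\<dots> = K ^ (2 * m) * (\<mu> ^ (2 * m)) ^ Suc n"
        by (simp only: power_mult_distrib power_mult[symmetric] mult.commute)
      also have "\<dots> = K ^ (2 * m) * c * c ^ n" by (simp add: \<mu>(2))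
      finally show "x (Suc n) ^ (2 * m) \<le> K ^ (2 * m) * c * c ^ n" .
    qed
  qed
  \<comment> \<open>Even exponents are unbounded; \<open>Suc n\<close> keeps the exponent
    positive.\<close>
  have "ereal B \<le> hardy_number (comb_domain x)" for B
  proof -
    obtain n :: nat where n: "B \<le> real n" using real_arch_simple by blast
    have "ereal B \<le> ereal (real (2 * Suc n))" using n by simp
    also have "\<dots> \<le> hardy_number (comb_domain x)"
      unfolding hardy_number_def f_def[symmetric] using mem[of "Suc n"]
      by (intro Sup_upper imageI) auto
    finally show ?thesis .
  qed
  then show ?thesis by (rule ereal_top)
qed

end
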